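(* Let $K\ge 1$ and $N>2K$ be integers, let $\rho>1$, and consider the circular full-view setting $\theta_s=2\pi s/N$, $s=1,\dots,N$, with the matrices $\mathbf{C},\mathbf{D}$ and the operator $\mathbf{L}(\mathbf{M})=\mathbf{C}\mathbf{D}\mathbf{M}\mathbf{D}\mathbf{C}^\top$ as defined in the context. For $a,b=1,\dots,2K$ let $\mathbf{e}_{ab}$ be the $2K\times 2K$ matrix whose elements are all zero except the $(a,b)$-th element, which is equal to $1$. Then, for $a,b=1,\dots,2K$, the $(a,b)$-th singular value of $\mathbf{L}$ is $$\lambda_{ab}=\frac{N}{8\pi^2\,\lceil a/2\rceil\,\lceil b/2\rceil\,\rho^{\lceil a/2\rceil+\lceil b/2\rceil}},$$ with the matrix $\mathbf{e}_{ab}$ as the right singular vector and $\mathbf{f}_{ab}=\lambda_{ab}^{-1}\mathbf{L}(\mathbf{e}_{ab})$ as the left singular vector. In particular, the condition number of the operator $\mathbf{L}$ is $K^2\rho^{2(K-1)}$.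
   Context: $\mathbf{C}$ is the real $N\times 2K$ matrix made of $1\times 2$ blocks $\mathbf{C}_{rm}=(\cos m\theta_r,\ \sin m\theta_r)$, $r=1,\dots,N$, $m=1,\dots,K$ (so its columns $2m-1$ and $2m$ have entries $\cos m\theta_r$ and $\sin m\theta_r$ respectively). $\mathbf{D}$ is the $2K\times 2K$ block-diagonal matrix $\mathbf{D}=\frac{1}{2\pi}\,\mathrm{diag}\big(\mathbf{I}_2/\rho,\ \mathbf{I}_2/(2\rho^2),\ \dots,\ \mathbf{I}_2/(K\rho^K)\big)$, where $\mathbf{I}_2$ is the $2\times2$ identity matrix. The operator $\mathbf{L}:\mathbb{R}^{2K\times 2K}\to\mathbb{R}^{N\times N}$ is $\mathbf{L}(\mathbf{M})=\mathbf{C}\mathbf{D}\mathbf{M}\mathbf{D}\mathbf{C}^\top$; matrix spaces carry the termwise (Frobenius) inner product. The singular values are indexed by pairs $(a,b)$ (no ordering by size is implied): the families $(\mathbf{e}_{ab})$ and $(\mathbf{f}_{ab})$ are orthonormal and $\mathbf{L}(\mathbf{e}_{ab})=\lambda_{ab}\mathbf{f}_{ab}$. The condition number of $\mathbf{L}$ is the ratio of its largest to its smallest singular value. $\lceil\cdot\rceil$ denotes the ceiling. *)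

theory Defs
  imports Complex_Main "HOL-Library.FuncSet" "Jordan_Normal_Form.Matrix"
begin

definition frobenius_inner :: "real mat \<Rightarrow> real mat \<Rightarrow> real" where
  "frobenius_inner A B = (\<Sum>i<dim_row A. \<Sum>j<dim_col A. A $$ (i, j) * B $$ (i, j))"

definition orthonormal_family :: "'i set \<Rightarrow> ('i \<Rightarrow> real mat) \<Rightarrow> bool" where
  "orthonormal_family I u \<longleftrightarrow>
     (\<forall>i\<in>I. \<forall>j\<in>I. frobenius_inner (u i) (u j) = (if i = j then 1 else 0))"

(* A complete orthonormal family: since the ambient matrix spaces are finite-dimensional,
   it is a basis as soon as only the zero matrix is orthogonal to all its members. *)
definition orthonormal_basis :: "real mat set \<Rightarrow> 'i set \<Rightarrow> ('i \<Rightarrow> real mat) \<Rightarrow> bool" where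
  "orthonormal_basis V I u \<longleftrightarrow>
     u \<in> I \<rightarrow> V \<and> orthonormal_family I u \<and>
     (\<forall>x\<in>V. (\<forall>i\<in>I. frobenius_inner x (u i) = 0) \<longrightarrow> x = 0\<^sub>m (dim_row x) (dim_col x))"

definition is_adjoint ::
  "real mat set \<Rightarrow> real mat set \<Rightarrow> (real mat \<Rightarrow> real mat) \<Rightarrow> (real mat \<Rightarrow> real mat) \<Rightarrow> bool" where
  "is_adjoint V W L L' \<longleftrightarrow>
     L \<in> V \<rightarrow> W \<and> L' \<in> W \<rightarrow> V \<and>
     (\<forall>x\<in>V. \<forall>y\<in>W. frobenius_inner (L x) y = frobenius_inner x (L' y))"

(* s is a singular value of L : V \<rightarrow> W with right singular vector u and left singular vector v:
   L u = s v and L* v = s u for unit vectors u, v. *)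
definition singular_triple ::
  "real mat set \<Rightarrow> real mat set \<Rightarrow> (real mat \<Rightarrow> real mat) \<Rightarrow> real \<Rightarrow> real mat \<Rightarrow> real mat \<Rightarrow> bool" where
  "singular_triple V W L s u v \<longleftrightarrow>
     s \<ge> 0 \<and> u \<in> V \<and> v \<in> W \<and> frobenius_inner u u = 1 \<and> frobenius_inner v v = 1 \<and>
     (\<exists>L'. is_adjoint V W L L' \<and> L u = s \<cdot>\<^sub>m v \<and> L' v = s \<cdot>\<^sub>m u)"

definition singular_values ::
  "real mat set \<Rightarrow> real mat set \<Rightarrow> (real mat \<Rightarrow> real mat) \<Rightarrow> real set" where
  "singular_values V W L = {s. \<exists>u v. singular_triple V W L s u v}"

(* Singular value decomposition with the singular values indexed by an arbitrary set I, in no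
   particular order.  The right singular vectors form an orthonormal basis of the whole domain V,
   so that the family s lists all singular values with multiplicity (case dim V \<le> dim W). *)
definition singular_value_decomposition ::
  "real mat set \<Rightarrow> real mat set \<Rightarrow> (real mat \<Rightarrow> real mat) \<Rightarrow> 'i set \<Rightarrow>
     ('i \<Rightarrow> real) \<Rightarrow> ('i \<Rightarrow> real mat) \<Rightarrow> ('i \<Rightarrow> real mat) \<Rightarrow> bool" where
  "singular_value_decomposition V W L I s u v \<longleftrightarrow>
     orthonormal_basis V I u \<and> orthonormal_family I v \<and>
     (\<forall>i\<in>I. singular_triple V W L (s i) (u i) (v i))"

definition condition_number ::
  "real mat set \<Rightarrow> real mat set \<Rightarrow> (real mat \<Rightarrow> real mat) \<Rightarrow> real" where
  "condition_number V W L = Max (singular_values V W L) / Min (singular_values V W L)"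

(* Matrix entries are indexed from 0 in the library: row i belongs to the angle \<theta> r, r = i + 1, and
   columns 2(m-1), 2(m-1)+1 hold the 1 \<times> 2 block of order m. *)
definition C_mat :: "nat \<Rightarrow> nat \<Rightarrow> (nat \<Rightarrow> real) \<Rightarrow> real mat" where
  "C_mat N K \<theta> = mat N (2 * K) (\<lambda>(i, j).
     let r = i + 1; m = j div 2 + 1
     in if even j then cos (real m * \<theta> r) else sin (real m * \<theta> r))"

definition D_mat :: "nat \<Rightarrow> real \<Rightarrow> real mat" where
  "D_mat K \<rho> = (1 / (2 * pi)) \<cdot>\<^sub>m
     diag_block_mat (map (\<lambda>m. (1 / (real m * \<rho> ^ m)) \<cdot>\<^sub>m 1\<^sub>m 2) [1..<K + 1])"

definition L_op :: "nat \<Rightarrow> nat \<Rightarrow> (nat \<Rightarrow> real) \<Rightarrow> real \<Rightarrow> real mat \<Rightarrow> real mat" where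
  "L_op N K \<theta> \<rho> M =
     C_mat N K \<theta> * D_mat K \<rho> * M * D_mat K \<rho> * transpose_mat (C_mat N K \<theta>)"

(* a, b are counted from 1, unlike the library's matrix indices. *)
definition e_mat :: "nat \<Rightarrow> nat \<Rightarrow> nat \<Rightarrow> real mat" where
  "e_mat K a b = mat (2 * K) (2 * K) (\<lambda>(i, j). if i + 1 = a \<and> j + 1 = b then 1 else 0)"

end

theory Submission
  imports Defs
begin

text \<open>
  With \<open>A = C D\<close> the operator is the congruence \<open>L(M) = A M A\<^sup>T\<close>, because \<open>D\<close> is symmetric.  Its
  adjoint for the Frobenius inner product is \<open>Y \<mapsto> A\<^sup>T Y A\<close>, so the normal operator is
  \<open>M \<mapsto> (A\<^sup>T A) M (A\<^sup>T A)\<close>.  When the columns of \<open>A\<close> are orthogonal, \<open>A\<^sup>T A\<close> is a diagonal matrix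
  with entries \<open>\<mu> i\<close>, the normal operator multiplies the entry \<open>(i, j)\<close> of \<open>M\<close> by \<open>\<mu> i \<mu> j\<close>, and
  the elementary matrices diagonalise it.  An orthonormal eigenbasis of the normal operator with
  positive eigenvalues \<open>s\<^sup>2\<close> is a system of right singular vectors with singular values \<open>s\<close>
  (\<open>svd_of_normal_eigenbasis\<close>).

  The geometry enters in one place.  At \<open>N\<close> equally spaced angles the sampled sines and cosines of
  orders \<open>1, ..., K\<close> are pairwise orthogonal with squared norm \<open>N / 2\<close>: the products become
  harmonics of the orders \<open>m + n\<close> and \<open>m - n\<close>, a harmonic sums to zero over the \<open>N\<close>-th roots of
  unity unless \<open>N\<close> divides its order, and \<open>0 < m + n \<le> 2 K < N\<close> leaves only the order \<open>m - n = 0\<close>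
  (\<open>discrete_trig_orthogonality\<close>).  Hence \<open>C\<^sup>T C = (N / 2) 1\<close> and \<open>\<mu> i\<close> is \<open>N / 2\<close> times the square
  of the diagonal entry of \<open>D\<close>.

  For the condition number one also has to know that the listed values are all the singular values.
  They are, since the right singular vectors of a decomposition form a basis of the domain
  (\<open>singular_values_of_svd\<close>).  Each value is a constant divided by \<open>g a * g b\<close> with \<open>g\<close> positive and
  nondecreasing, so the extremes sit at the corners of the index square.
\<close>

section \<open>Trigonometric sums over equally spaced angles\<close>

text \<open>
  The summands are the powers \<open>z, z\<^sup>2, ..., z\<^sup>N\<close> of \<open>z = exp (2 \<pi> \<i> k / N)\<close>.  As \<open>z\<^sup>N = 1\<close>, their
  geometric sum vanishes unless \<open>z = 1\<close>, that is, unless \<open>N\<close> divides \<open>k\<close>.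
\<close>
lemma sum_cis_equally_spaced:
  fixes k :: int and N :: nat
  assumes "N > 0"
  shows "(\<Sum>i<N. cis (of_int k * (2 * pi * real (i + 1) / real N))) =
         (if int N dvd k then of_nat N else 0)"
proof -
  define z where "z = cis (of_int k * (2 * pi / real N))"
  have term_eq: "cis (of_int k * (2 * pi * real (i + 1) / real N)) = z * z ^ i" for i
  proof -
    have "of_int k * (2 * pi * real (i + 1) / real N)
        = real (Suc i) * (of_int k * (2 * pi / real N))"
      by (simp add: field_simps)
    then show ?thesis
      unfolding z_def by (simp only: DeMoivre[symmetric] power_Suc)
  qed
  have zN: "z ^ N = 1"
  proof -
    have "z ^ N = cis (2 * pi * of_int k)"
      unfolding z_def DeMoivre using assms by (simp add: field_simps)
    then show ?thesis
      by simp
  qed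
  have z1: "z = 1 \<longleftrightarrow> int N dvd k"
  proof
    assume "z = 1"
    then have "cos (of_int k * (2 * pi / real N)) = 1"
      unfolding z_def by (metis cis.sel(1) one_complex.sel(1))
    then obtain j :: int where "of_int k * (2 * pi / real N) = of_int j * 2 * pi"
      using cos_one_2pi_int by auto
    then have "real_of_int k = real_of_int (j * int N)"
      using assms by (simp add: field_simps)
    then have "k = j * int N"
      by (simp only: of_int_eq_iff)
    then show "int N dvd k"
      by simp
  next
    assume "int N dvd k"
    then obtain j where "k = int N * j" ..
    then have "of_int k * (2 * pi / real N) = 2 * pi * of_int j"
      using assms by simp
    then show "z = 1"
      unfolding z_def by simp
  qed
  have "(\<Sum>i<N. cis (of_int k * (2 * pi * real (i + 1) / real N))) = z * (\<Sum>i<N. z ^ i)"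
    unfolding term_eq by (simp add: sum_distrib_left)
  also have "\<dots> = (if int N dvd k then of_nat N else 0)"
  proof (cases "z = 1")
    case False
    then have "(\<Sum>i<N. z ^ i) = 0"
      using geometric_sum[OF False, of N] zN by simp
    then show ?thesis
      using False z1 by simp
  qed (use z1 in simp)
  finally show ?thesis .
qed

lemma sum_cos_equally_spaced:
  fixes k :: int and N :: nat
  assumes "N > 0"
  shows "(\<Sum>i<N. cos (of_int k * (2 * pi * real (i + 1) / real N))) =
         (if int N dvd k then real N else 0)"
  using arg_cong[OF sum_cis_equally_spaced[OF assms, of k], of Re] by simp

lemma sum_sin_equally_spaced:
  fixes k :: int and N :: nat
  assumes "N > 0"
  shows "(\<Sum>i<N. sin (of_int k * (2 * pi * real (i + 1) / real N))) = 0"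
  using arg_cong[OF sum_cis_equally_spaced[OF assms, of k], of Im] by simp

text \<open>
  The product-to-sum formulas leave harmonics of the orders \<open>m + n\<close> and \<open>m - n\<close>.  The first order
  lies strictly between \<open>0\<close> and \<open>N\<close>, and the second one is smaller than \<open>N\<close> in absolute value, so a
  cosine sum survives only for \<open>m = n\<close>.  Sine sums always vanish.
\<close>
lemma discrete_trig_orthogonality:
  fixes m n N :: nat
  defines "x \<equiv> \<lambda>i. 2 * pi * real (i + 1) / real N"
  assumes "m > 0" "n > 0" "m + n < N"
  shows "(\<Sum>i<N. cos (real m * x i) * cos (real n * x i)) = (if m = n then real N / 2 else 0)"
    and "(\<Sum>i<N. sin (real m * x i) * sin (real n * x i)) = (if m = n then real N / 2 else 0)"
    and "(\<Sum>i<N. sin (real m * x i) * cos (real n * x i)) = 0"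
    and "(\<Sum>i<N. cos (real m * x i) * sin (real n * x i)) = 0"
proof -
  have N: "N > 0"
    using assms by simp
  have add: "\<not> int N dvd (int m + int n)"
    using assms by (auto dest!: zdvd_imp_le)
  have diff: "int N dvd (int m - int n) \<longleftrightarrow> m = n"
  proof
    assume "int N dvd (int m - int n)"
    then have "int m - int n = 0"
      using assms(2-4) dvd_imp_le_int[of "int m - int n" "int N"] by linarith
    then show "m = n"
      by simp
  qed simp
  have to_sum: "real m * x i + real n * x i = of_int (int m + int n) * x i"
    and to_diff: "real m * x i - real n * x i = of_int (int m - int n) * x i" for i
    by (simp_all add: algebra_simps)
  have cosS: "(\<Sum>i<N. cos (of_int k * x i)) = (if int N dvd k then real N else 0)"
    and sinS: "(\<Sum>i<N. sin (of_int k * x i)) = 0" for k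
    unfolding x_def by (rule sum_cos_equally_spaced[OF N] sum_sin_equally_spaced[OF N])+
  show "(\<Sum>i<N. cos (real m * x i) * cos (real n * x i)) = (if m = n then real N / 2 else 0)"
    unfolding cos_times_cos to_sum to_diff sum_divide_distrib[symmetric] sum.distrib cosS
    using add diff by simp
  show "(\<Sum>i<N. sin (real m * x i) * sin (real n * x i)) = (if m = n then real N / 2 else 0)"
    unfolding sin_times_sin to_sum to_diff sum_divide_distrib[symmetric] sum_subtractf cosS
    using add diff by simp
  show "(\<Sum>i<N. sin (real m * x i) * cos (real n * x i)) = 0"
    unfolding sin_times_cos to_sum to_diff sum_divide_distrib[symmetric] sum.distrib sinS
    by simp
  show "(\<Sum>i<N. cos (real m * x i) * sin (real n * x i)) = 0"
    unfolding cos_times_sin to_sum to_diff sum_divide_distrib[symmetric] sum_subtractf sinS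
    by simp
qed

section \<open>The Gram matrix of the weighted sampling matrix\<close>

lemma C_mat_gram:
  assumes "N > 2 * K" and "\<And>s. s \<in> {1..N} \<Longrightarrow> \<theta> s = 2 * pi * real s / real N"
  shows "transpose_mat (C_mat N K \<theta>) * C_mat N K \<theta> = mat_diag (2 * K) (\<lambda>j. real N / 2)"
proof (rule eq_matI)
  fix p q assume "p < dim_row (mat_diag (2 * K) (\<lambda>j. real N / 2))"
    and "q < dim_col (mat_diag (2 * K) (\<lambda>j. real N / 2))"
  then have pq: "p < 2 * K" "q < 2 * K"
    by (simp_all add: mat_diag_def)
  define m where "m = p div 2 + 1"
  define n where "n = q div 2 + 1"
  have mn: "m > 0" "n > 0" "m + n < N"
    using assms(1) less_mult_imp_div_less[of p K 2] less_mult_imp_div_less[of q K 2] pq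
    unfolding m_def n_def by linarith+
  have \<theta>: "\<theta> (i + 1) = 2 * pi * real (i + 1) / real N" if "i < N" for i
    using that by (intro assms(2)) auto
  (* A column is determined by the order of its harmonic and by its choice of cosine or sine. *)
  have pq_eq: "p = q \<longleftrightarrow> m = n \<and> (even p \<longleftrightarrow> even q)"
    unfolding m_def n_def by presburger
  have "(transpose_mat (C_mat N K \<theta>) * C_mat N K \<theta>) $$ (p, q) =
     (\<Sum>i<N. (if even p then cos (real m * \<theta> (i + 1)) else sin (real m * \<theta> (i + 1))) *
            (if even q then cos (real n * \<theta> (i + 1)) else sin (real n * \<theta> (i + 1))))"
    using pq by (cases "even p"; cases "even q")
      (simp_all add: C_mat_def scalar_prod_def m_def n_def Let_def atLeast0LessThan)
  also have "\<dots> = (\<Sum>i<N.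
     (if even p then cos (real m * (2 * pi * real (i + 1) / real N))
                else sin (real m * (2 * pi * real (i + 1) / real N))) *
     (if even q then cos (real n * (2 * pi * real (i + 1) / real N))
                else sin (real n * (2 * pi * real (i + 1) / real N))))"
    by (intro sum.cong refl) (simp only: \<theta> lessThan_iff)
  also have "\<dots> = (if p = q then real N / 2 else 0)"
    unfolding pq_eq using discrete_trig_orthogonality[OF mn]
    by (cases "even p"; cases "even q") (simp_all only: if_True if_False simp_thms)
  also have "\<dots> = mat_diag (2 * K) (\<lambda>j. real N / 2) $$ (p, q)"
    using pq by (simp add: mat_diag_def)
  finally show "(transpose_mat (C_mat N K \<theta>) * C_mat N K \<theta>) $$ (p, q) =
    mat_diag (2 * K) (\<lambda>j. real N / 2) $$ (p, q)" .
qed (simp_all add: C_mat_def mat_diag_def)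

lemma diag_block_mat_scalar_blocks:
  fixes c :: "nat \<Rightarrow> 'a :: semiring_1"
  shows "diag_block_mat (map (\<lambda>m. c m \<cdot>\<^sub>m 1\<^sub>m 2) [1..<K + 1]) =
         mat_diag (2 * K) (\<lambda>j. c (j div 2 + 1))"
proof (induction K)
  case 0
  show ?case
    by (auto simp: mat_diag_def)
next
  case (Suc K)
  have div: "i div 2 = K" if "i < Suc (Suc (2 * K))" "\<not> i < 2 * K" for i
    using that by linarith
  have "diag_block_mat (map (\<lambda>m. c m \<cdot>\<^sub>m 1\<^sub>m 2) [1..<Suc K + 1]) =
    four_block_mat (mat_diag (2 * K) (\<lambda>j. c (j div 2 + 1))) (0\<^sub>m (2 * K) 2)
      (0\<^sub>m 2 (2 * K)) (c (K + 1) \<cdot>\<^sub>m 1\<^sub>m 2)"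
    using Suc.IH by (simp add: diag_block_mat_last Let_def mat_diag_def)
  also have "\<dots> = mat_diag (2 * Suc K) (\<lambda>j. c (j div 2 + 1))"
    by (rule eq_matI) (auto simp: mat_diag_def div)
  finally show ?case .
qed

lemma D_mat_diag:
  "D_mat K \<rho> = mat_diag (2 * K) (\<lambda>j. 1 / (2 * pi * (real (j div 2 + 1) * \<rho> ^ (j div 2 + 1))))"
  unfolding D_mat_def diag_block_mat_scalar_blocks
  by (rule eq_matI) (auto simp: mat_diag_def)

lemma D_mat_symmetric: "transpose_mat (D_mat K \<rho>) = D_mat K \<rho>"
  unfolding D_mat_diag by (rule eq_matI) (auto simp: mat_diag_def)

text \<open>
  As \<open>C\<^sup>T C\<close> is a multiple of the identity, it commutes past \<open>D\<close> and the columns of \<open>C D\<close> stay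
  orthogonal.
\<close>
lemma CD_gram:
  fixes \<rho> :: real
  assumes "N > 2 * K" and "\<And>s. s \<in> {1..N} \<Longrightarrow> \<theta> s = 2 * pi * real s / real N"
  defines "A \<equiv> C_mat N K \<theta> * D_mat K \<rho>"
  shows "transpose_mat A * A =
    mat_diag (2 * K) (\<lambda>j. real N / (8 * pi\<^sup>2 * (real (j div 2 + 1) * \<rho> ^ (j div 2 + 1))\<^sup>2))"
proof -
  let ?C = "C_mat N K \<theta>" and ?D = "D_mat K \<rho>"
  have C: "?C \<in> carrier_mat N (2 * K)" and D: "?D \<in> carrier_mat (2 * K) (2 * K)"
    by (simp_all add: C_mat_def D_mat_diag)
  have "transpose_mat A * A = ?D * ((transpose_mat ?C * ?C) * ?D)"
    unfolding A_def using C D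
    by (simp add: transpose_mult D_mat_symmetric assoc_mult_mat[of _ "2*K" "2*K" _ N _ "2*K"]
        assoc_mult_mat[of _ "2*K" N _ "2*K" _ "2*K"])
  also have "transpose_mat ?C * ?C = mat_diag (2 * K) (\<lambda>j. real N / 2)"
    using assms(1,2) by (rule C_mat_gram)
  also have "?D * (\<dots> * ?D) = mat_diag (2 * K)
      (\<lambda>j. real N / (8 * pi\<^sup>2 * (real (j div 2 + 1) * \<rho> ^ (j div 2 + 1))\<^sup>2))"
    unfolding D_mat_diag mat_diag_diag
    by (rule arg_cong[of _ _ "mat_diag (2 * K)"]) (simp add: power2_eq_square algebra_simps)
  finally show ?thesis .
qed

section \<open>The Frobenius inner product\<close>

lemma frobenius_inner_smult_left [simp]:
  "frobenius_inner (c \<cdot>\<^sub>m X) Y = c * frobenius_inner X Y"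
  by (simp add: frobenius_inner_def sum_distrib_left mult.assoc)

lemma frobenius_inner_commute:
  "X \<in> carrier_mat m n \<Longrightarrow> Y \<in> carrier_mat m n \<Longrightarrow> frobenius_inner X Y = frobenius_inner Y X"
  by (simp add: frobenius_inner_def mult.commute)

lemma frobenius_inner_smult_right:
  "X \<in> carrier_mat m n \<Longrightarrow> Y \<in> carrier_mat m n \<Longrightarrow>
   frobenius_inner X (c \<cdot>\<^sub>m Y) = c * frobenius_inner X Y"
  by (simp add: frobenius_inner_def sum_distrib_left mult.left_commute)

lemma frobenius_inner_transpose:
  "X \<in> carrier_mat m n \<Longrightarrow> Y \<in> carrier_mat m n \<Longrightarrow>
   frobenius_inner (transpose_mat X) (transpose_mat Y) = frobenius_inner X Y"
  unfolding frobenius_inner_def by (subst sum.swap) simp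

lemma frobenius_inner_mult_left:
  assumes "A \<in> carrier_mat m k" "X \<in> carrier_mat k n" "Y \<in> carrier_mat m n"
  shows "frobenius_inner (A * X) Y = frobenius_inner X (transpose_mat A * Y)"
proof -
  have "frobenius_inner (A * X) Y =
      (\<Sum>i<m. \<Sum>j<n. \<Sum>l<k. A $$ (i, l) * X $$ (l, j) * Y $$ (i, j))"
    using assms by (simp add: frobenius_inner_def scalar_prod_def atLeast0LessThan sum_distrib_right)
  also have "\<dots> = (\<Sum>i<m. \<Sum>l<k. \<Sum>j<n. A $$ (i, l) * X $$ (l, j) * Y $$ (i, j))"
    by (intro sum.cong refl sum.swap)
  also have "\<dots> = (\<Sum>l<k. \<Sum>i<m. \<Sum>j<n. A $$ (i, l) * X $$ (l, j) * Y $$ (i, j))"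
    by (rule sum.swap)
  also have "\<dots> = (\<Sum>l<k. \<Sum>j<n. \<Sum>i<m. A $$ (i, l) * X $$ (l, j) * Y $$ (i, j))"
    by (intro sum.cong refl sum.swap)
  also have "\<dots> = frobenius_inner X (transpose_mat A * Y)"
    using assms by (simp add: frobenius_inner_def scalar_prod_def atLeast0LessThan
        sum_distrib_left mult.commute mult.left_commute)
  finally show ?thesis .
qed

text \<open>Transposition is an isometry that turns right multiplication into left multiplication.\<close>
lemma frobenius_inner_mult_right:
  assumes "B \<in> carrier_mat k n" "X \<in> carrier_mat m k" "Y \<in> carrier_mat m n"
  shows "frobenius_inner (X * B) Y = frobenius_inner X (Y * transpose_mat B)"
proof -
  have "frobenius_inner (X * B) Y
      = frobenius_inner (transpose_mat B * transpose_mat X) (transpose_mat Y)"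
    using assms by (simp flip: frobenius_inner_transpose[of "X * B" m n Y] transpose_mult)
  also have "\<dots> = frobenius_inner (transpose_mat X) (B * transpose_mat Y)"
    using assms by (simp add: frobenius_inner_mult_left[of _ n k _ m])
  also have "B * transpose_mat Y = transpose_mat (Y * transpose_mat B)"
    using assms by (simp add: transpose_mult[of Y m n _ k])
  also have "frobenius_inner (transpose_mat X) \<dots> = frobenius_inner X (Y * transpose_mat B)"
    using assms by (intro frobenius_inner_transpose[of _ m k]) auto
  finally show ?thesis .
qed

lemma congruence_adjoint:
  assumes A: "A \<in> carrier_mat n k"
  shows "is_adjoint (carrier_mat k k) (carrier_mat n n)
           (\<lambda>M. A * M * transpose_mat A) (\<lambda>Y. transpose_mat A * Y * A)"
  unfolding is_adjoint_def
proof (intro conjI ballI)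
  fix X Y :: "real mat" assume X: "X \<in> carrier_mat k k" and Y: "Y \<in> carrier_mat n n"
  have "frobenius_inner (A * X * transpose_mat A) Y = frobenius_inner (A * X) (Y * A)"
    using A X Y frobenius_inner_mult_right[of "transpose_mat A" k n "A * X" n Y] by simp
  also have "\<dots> = frobenius_inner X (transpose_mat A * (Y * A))"
    using A X Y by (intro frobenius_inner_mult_left[of _ n k _ k]) auto
  also have "transpose_mat A * (Y * A) = transpose_mat A * Y * A"
    using A Y by (intro assoc_mult_mat[symmetric, of _ k n _ n _ k]) auto
  finally show "frobenius_inner (A * X * transpose_mat A) Y =
    frobenius_inner X (transpose_mat A * Y * A)" .
qed (use A in auto)

section \<open>Singular value decompositions from the normal operator\<close>

text \<open>
  The images \<open>L (u i)\<close> are orthogonal because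
  \<open>\<langle>L (u i), L (u j)\<rangle> = \<langle>u i, L' (L (u j))\<rangle> = (s j)\<^sup>2 \<langle>u i, u j\<rangle>\<close>; dividing by \<open>s i\<close> normalises them.
\<close>
lemma svd_of_normal_eigenbasis:
  fixes u :: "'i \<Rightarrow> real mat"
  assumes V: "V = carrier_mat m n" and W: "W = carrier_mat p q"
    and adj: "is_adjoint V W L L'"
    and L'_scale: "\<And>c y. y \<in> W \<Longrightarrow> L' (c \<cdot>\<^sub>m y) = c \<cdot>\<^sub>m L' y"
    and basis: "orthonormal_basis V I u"
    and pos: "\<And>i. i \<in> I \<Longrightarrow> s i > 0"
    and eigen: "\<And>i. i \<in> I \<Longrightarrow> L' (L (u i)) = (s i)\<^sup>2 \<cdot>\<^sub>m u i"
  shows "singular_value_decomposition V W L I s u (\<lambda>i. inverse (s i) \<cdot>\<^sub>m L (u i))"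
proof -
  have u_V: "u i \<in> V" and Lu_W: "L (u i) \<in> W" if "i \<in> I" for i
    using that basis adj by (auto simp: orthonormal_basis_def is_adjoint_def)
  have orth: "frobenius_inner (u i) (u j) = (if i = j then 1 else 0)" if "i \<in> I" "j \<in> I" for i j
    using that basis by (auto simp: orthonormal_basis_def orthonormal_family_def)
  have v_orth: "frobenius_inner (inverse (s i) \<cdot>\<^sub>m L (u i)) (inverse (s j) \<cdot>\<^sub>m L (u j)) =
      (if i = j then 1 else 0)" if i: "i \<in> I" and j: "j \<in> I" for i j
  proof -
    have "frobenius_inner (L (u i)) (L (u j)) = frobenius_inner (u i) (L' (L (u j)))"
      using adj u_V[OF i] Lu_W[OF j] by (simp add: is_adjoint_def)
    also have "\<dots> = (s j)\<^sup>2 * (if i = j then 1 else 0)"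
      using u_V[OF i] u_V[OF j] orth[OF i j]
      by (simp add: eigen[OF j] V frobenius_inner_smult_right)
    finally show ?thesis
      using Lu_W[OF i] Lu_W[OF j] pos[OF j]
      by (auto simp: W frobenius_inner_smult_right power2_eq_square field_simps)
  qed
  have "singular_triple V W L (s i) (u i) (inverse (s i) \<cdot>\<^sub>m L (u i))" if i: "i \<in> I" for i
    unfolding singular_triple_def
  proof (intro conjI exI[of _ L'])
    show "L (u i) = s i \<cdot>\<^sub>m (inverse (s i) \<cdot>\<^sub>m L (u i))"
      using pos[OF i] by (intro eq_matI) auto
    show "L' (inverse (s i) \<cdot>\<^sub>m L (u i)) = s i \<cdot>\<^sub>m u i"
      unfolding L'_scale[OF Lu_W[OF i]] eigen[OF i]
      using pos[OF i] by (intro eq_matI) (auto simp: power2_eq_square)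
    show "inverse (s i) \<cdot>\<^sub>m L (u i) \<in> W"
      using Lu_W[OF i] by (simp add: W)
  qed (use pos[OF i] u_V[OF i] orth[OF i i] v_orth[OF i i] adj in auto)
  then show ?thesis
    using basis v_orth by (simp add: singular_value_decomposition_def orthonormal_family_def)
qed

text \<open>
  Let \<open>t\<close> be a singular value with right singular vector \<open>x\<close>.  Some \<open>u i\<close> is not orthogonal to
  \<open>x\<close>.  Moving \<open>L\<close> to the other side of \<open>\<langle>L x, L (u i)\<rangle>\<close>, once at each factor, evaluates this
  product as \<open>(s i)\<^sup>2 \<langle>x, u i\<rangle>\<close> and as \<open>t\<^sup>2 \<langle>x, u i\<rangle>\<close>, whence \<open>t = s i\<close>.
\<close>
lemma singular_values_of_svd:
  assumes V: "V = carrier_mat m n" and W: "W = carrier_mat p q"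
    and svd: "singular_value_decomposition V W L I s u v"
  shows "singular_values V W L = s ` I"
proof
  show "s ` I \<subseteq> singular_values V W L"
    using svd by (auto simp: singular_value_decomposition_def singular_values_def)
next
  show "singular_values V W L \<subseteq> s ` I"
  proof
    fix t assume "t \<in> singular_values V W L"
    then obtain x y where "singular_triple V W L t x y"
      by (auto simp: singular_values_def)
    then obtain T where t: "t \<ge> 0" and x: "x \<in> V" and y: "y \<in> W" and xx: "frobenius_inner x x = 1"
      and T: "is_adjoint V W L T" and Lx: "L x = t \<cdot>\<^sub>m y" and Ty: "T y = t \<cdot>\<^sub>m x"
      by (auto simp: singular_triple_def)
    have "x \<noteq> 0\<^sub>m (dim_row x) (dim_col x)"
    proof
      assume "x = 0\<^sub>m (dim_row x) (dim_col x)"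
      then have "frobenius_inner x x = 0"
        unfolding frobenius_inner_def
        by (metis (no_types, lifting) index_zero_mat(1) lessThan_iff mult_zero_left sum.neutral)
      with xx show False
        by simp
    qed
    then obtain i where i: "i \<in> I" and xi: "frobenius_inner x (u i) \<noteq> 0"
      using svd x unfolding singular_value_decomposition_def orthonormal_basis_def by blast
    have "singular_triple V W L (s i) (u i) (v i)"
      using svd i by (auto simp: singular_value_decomposition_def)
    then obtain S where si: "s i \<ge> 0" and ui: "u i \<in> V" and vi: "v i \<in> W"
      and S: "is_adjoint V W L S" and Lu: "L (u i) = s i \<cdot>\<^sub>m v i" and Sv: "S (v i) = s i \<cdot>\<^sub>m u i"
      by (auto simp: singular_triple_def)
    (* Each triple comes with its own adjoint, S or T, which is evaluated only at the left singular
       vector of that triple. *)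
    have "frobenius_inner (L x) (L (u i)) = s i * frobenius_inner x (S (v i))"
    proof -
      have "L x \<in> W"
        using S x by (auto simp: is_adjoint_def)
      then have "frobenius_inner (L x) (L (u i)) = s i * frobenius_inner (L x) (v i)"
        using vi by (simp add: Lu W frobenius_inner_smult_right)
      then show ?thesis
        using S x vi by (simp add: is_adjoint_def)
    qed
    also have "\<dots> = (s i)\<^sup>2 * frobenius_inner x (u i)"
      using x ui by (simp add: Sv V frobenius_inner_smult_right power2_eq_square)
    finally have 1: "frobenius_inner (L x) (L (u i)) = (s i)\<^sup>2 * frobenius_inner x (u i)" .
    have "frobenius_inner (L x) (L (u i)) = t * frobenius_inner (u i) (T y)"
    proof -
      have "L (u i) \<in> W"
        using S ui by (auto simp: is_adjoint_def)
      then have "frobenius_inner (L x) (L (u i)) = t * frobenius_inner (L (u i)) y"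
        using y by (simp add: Lx W frobenius_inner_commute)
      then show ?thesis
        using T ui y by (simp add: is_adjoint_def)
    qed
    also have "\<dots> = t\<^sup>2 * frobenius_inner x (u i)"
      using x ui
      by (simp add: Ty V frobenius_inner_smult_right frobenius_inner_commute[of x m n]
          power2_eq_square)
    finally have "t\<^sup>2 = (s i)\<^sup>2"
      using 1 xi by simp
    then have "t = s i"
      using t si by (simp add: power2_eq_iff_nonneg)
    then show "t \<in> s ` I"
      using i by simp
  qed
qed

section \<open>Congruences with orthogonal columns\<close>

lemma frobenius_inner_e_mat:
  assumes "X \<in> carrier_mat (2 * K) (2 * K)" "a \<in> {1..2 * K}" "b \<in> {1..2 * K}"
  shows "frobenius_inner X (e_mat K a b) = X $$ (a - 1, b - 1)"
proof -
  have less: "a - 1 < 2 * K" "b - 1 < 2 * K"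
    using assms by auto
  have "frobenius_inner X (e_mat K a b) =
    (\<Sum>i<2 * K. \<Sum>j<2 * K. if j = b - 1 then if i = a - 1 then X $$ (i, j) else 0 else 0)"
    unfolding frobenius_inner_def using assms
    by (intro sum.cong) (auto simp: e_mat_def)
  also have "\<dots> = X $$ (a - 1, b - 1)"
    using less by simp
  finally show ?thesis .
qed

lemma e_mat_orthonormal_basis:
  "orthonormal_basis (carrier_mat (2 * K) (2 * K)) ({1..2 * K} \<times> {1..2 * K}) (\<lambda>(a, b). e_mat K a b)"
proof -
  have e: "e_mat K a b \<in> carrier_mat (2 * K) (2 * K)" for a b
    by (simp add: e_mat_def)
  have "orthonormal_family ({1..2 * K} \<times> {1..2 * K}) (\<lambda>(a, b). e_mat K a b)"
    unfolding orthonormal_family_def using frobenius_inner_e_mat[OF e]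
    by (auto simp: e_mat_def)
  moreover have "X = 0\<^sub>m (2 * K) (2 * K)"
    if X: "X \<in> carrier_mat (2 * K) (2 * K)"
      and orth: "\<forall>p\<in>{1..2 * K} \<times> {1..2 * K}. frobenius_inner X (case p of (a, b) \<Rightarrow> e_mat K a b) = 0"
    for X
  proof (rule eq_matI)
    fix i j assume "i < dim_row (0\<^sub>m (2 * K) (2 * K) :: real mat)"
      and "j < dim_col (0\<^sub>m (2 * K) (2 * K) :: real mat)"
    then have "i < 2 * K" "j < 2 * K"
      by simp_all
    then show "X $$ (i, j) = 0\<^sub>m (2 * K) (2 * K) $$ (i, j)"
      using orth[rule_format, of "(i + 1, j + 1)"] frobenius_inner_e_mat[OF X, of "i + 1" "j + 1"]
      by simp
  qed (use X in auto)
  ultimately show ?thesis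
    unfolding orthonormal_basis_def using e by auto
qed

text \<open>
  Regrouped as \<open>(A\<^sup>T A) E (A\<^sup>T A)\<close>, the left-hand side scales the rows and the columns of an
  elementary matrix, which has a single nonzero entry.  The shift by one translates between the
  numbering of \<open>E\<close> from 1 and the numbering of matrix entries from 0.
\<close>
lemma congruence_normal_e_mat:
  assumes A: "A \<in> carrier_mat n (2 * K)"
    and gram: "transpose_mat A * A = mat_diag (2 * K) \<mu>"
  shows "transpose_mat A * (A * e_mat K a b * transpose_mat A) * A =
         (\<mu> (a - 1) * \<mu> (b - 1)) \<cdot>\<^sub>m e_mat K a b"
proof -
  let ?E = "e_mat K a b"
  have E: "?E \<in> carrier_mat (2 * K) (2 * K)"
    by (simp add: e_mat_def)
  have "transpose_mat A * (A * ?E * transpose_mat A) * A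
      = (transpose_mat A * A) * ?E * (transpose_mat A * A)"
  proof -
    have "transpose_mat A * (A * ?E * transpose_mat A) * A
        = transpose_mat A * ((A * ?E * transpose_mat A) * A)"
      using A E by (intro assoc_mult_mat[of _ "2*K" n _ n _ "2*K"]) auto
    also have "(A * ?E * transpose_mat A) * A = (A * ?E) * (transpose_mat A * A)"
      using A E by (intro assoc_mult_mat[of _ n "2*K" _ n _ "2*K"]) auto
    also have "transpose_mat A * \<dots> = (transpose_mat A * (A * ?E)) * (transpose_mat A * A)"
      using A E by (intro assoc_mult_mat[symmetric, of _ "2*K" n _ "2*K" _ "2*K"]) auto
    also have "transpose_mat A * (A * ?E) = (transpose_mat A * A) * ?E"
      using A E by (intro assoc_mult_mat[symmetric, of _ "2*K" n _ "2*K" _ "2*K"]) auto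
    finally show ?thesis .
  qed
  also have "\<dots> = (\<mu> (a - 1) * \<mu> (b - 1)) \<cdot>\<^sub>m ?E"
    unfolding gram mat_diag_mult_left[OF E]
    by (subst mat_diag_mult_right[of _ "2 * K"], simp, rule eq_matI) (auto simp: e_mat_def)
  finally show ?thesis .
qed

lemma congruence_svd:
  assumes A: "A \<in> carrier_mat n (2 * K)"
    and gram: "transpose_mat A * A = mat_diag (2 * K) \<mu>"
    and L: "\<And>M. M \<in> carrier_mat (2 * K) (2 * K) \<Longrightarrow> L M = A * M * transpose_mat A"
    and pos: "\<And>a b. a \<in> {1..2 * K} \<Longrightarrow> b \<in> {1..2 * K} \<Longrightarrow> s (a, b) > 0"
    and s: "\<And>a b. a \<in> {1..2 * K} \<Longrightarrow> b \<in> {1..2 * K} \<Longrightarrow> (s (a, b))\<^sup>2 = \<mu> (a - 1) * \<mu> (b - 1)"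
  shows "singular_value_decomposition (carrier_mat (2 * K) (2 * K)) (carrier_mat n n) L
    ({1..2 * K} \<times> {1..2 * K}) s (\<lambda>(a, b). e_mat K a b)
    (\<lambda>p. inverse (s p) \<cdot>\<^sub>m L (case p of (a, b) \<Rightarrow> e_mat K a b))"
proof (rule svd_of_normal_eigenbasis[OF refl refl, where L' = "\<lambda>Y. transpose_mat A * Y * A"])
  show "is_adjoint (carrier_mat (2 * K) (2 * K)) (carrier_mat n n) L (\<lambda>Y. transpose_mat A * Y * A)"
    using congruence_adjoint[OF A] L by (simp add: is_adjoint_def Pi_iff)
  show "transpose_mat A * (c \<cdot>\<^sub>m Y) * A = c \<cdot>\<^sub>m (transpose_mat A * Y * A)"
    if "Y \<in> carrier_mat n n" for c Y
    using A that by (simp add: mult_smult_distrib[of _ "2*K" n _ n]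
        mult_smult_assoc_mat[of _ "2*K" n _ "2*K"])
  show "orthonormal_basis (carrier_mat (2 * K) (2 * K)) ({1..2 * K} \<times> {1..2 * K})
    (\<lambda>(a, b). e_mat K a b)"
    by (rule e_mat_orthonormal_basis)
  show "s p > 0" if "p \<in> {1..2 * K} \<times> {1..2 * K}" for p
    using that pos by auto
  show "transpose_mat A * L (case p of (a, b) \<Rightarrow> e_mat K a b) * A =
      (s p)\<^sup>2 \<cdot>\<^sub>m (case p of (a, b) \<Rightarrow> e_mat K a b)"
    if p: "p \<in> {1..2 * K} \<times> {1..2 * K}" for p
  proof -
    obtain a b where ab: "p = (a, b)" "a \<in> {1..2 * K}" "b \<in> {1..2 * K}"
      using p by auto
    have "e_mat K a b \<in> carrier_mat (2 * K) (2 * K)"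
      by (simp add: e_mat_def)
    then show ?thesis
      using congruence_normal_e_mat[OF A gram, of a b] s[OF ab(2,3)] by (simp add: ab(1) L)
  qed
qed

text \<open>
  Symmetry of \<open>D\<close> turns the right factor \<open>D C\<^sup>T\<close> into \<open>(C D)\<^sup>T\<close>.  Regrouping the product relies on
  \<open>M\<close> having the matching size.
\<close>
lemma L_op_congruence:
  assumes "M \<in> carrier_mat (2 * K) (2 * K)"
  shows "L_op N K \<theta> \<rho> M =
    (C_mat N K \<theta> * D_mat K \<rho>) * M * transpose_mat (C_mat N K \<theta> * D_mat K \<rho>)"
proof -
  have C: "C_mat N K \<theta> \<in> carrier_mat N (2 * K)" and D: "D_mat K \<rho> \<in> carrier_mat (2 * K) (2 * K)"
    by (simp_all add: C_mat_def D_mat_diag)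
  have CDM: "C_mat N K \<theta> * D_mat K \<rho> * M \<in> carrier_mat N (2 * K)"
    using C D assms by auto
  have "L_op N K \<theta> \<rho> M =
      (C_mat N K \<theta> * D_mat K \<rho> * M) * (D_mat K \<rho> * transpose_mat (C_mat N K \<theta>))"
    unfolding L_op_def using C D
    by (intro assoc_mult_mat[OF CDM D]) auto
  then show ?thesis
    by (simp add: transpose_mult[OF C D] D_mat_symmetric)
qed

section \<open>Extremal singular values\<close>

lemma ceiling_half: "\<lceil>real a / 2\<rceil> = int ((a + 1) div 2)"
  by linarith

lemma Max_Min_ratio_product:
  fixes g :: "nat \<Rightarrow> real" and c :: real
  assumes "1 \<le> n" "c > 0" "g 1 > 0"
    and mono: "\<And>a b. 1 \<le> a \<Longrightarrow> a \<le> b \<Longrightarrow> b \<le> n \<Longrightarrow> g a \<le> g b"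
  defines "S \<equiv> (\<lambda>(a, b). c / (g a * g b)) ` ({1..n} \<times> {1..n})"
  shows "Max S / Min S = (g n / g 1)\<^sup>2"
proof -
  have bounds: "0 < g 1" "g 1 \<le> g a" "g a \<le> g n" "0 < g a" if "a \<in> {1..n}" for a
    using that assms(3) mono[of 1 a] mono[of a n] by auto
  have fin: "finite S"
    by (simp add: S_def)
  have mem: "c / (g a * g b) \<in> S" if "a \<in> {1..n}" "b \<in> {1..n}" for a b
    unfolding S_def using that by (intro image_eqI[of _ _ "(a, b)"]) auto
  have "Max S = c / (g 1 * g 1)"
  proof (rule Max_eqI[OF fin])
    fix y assume "y \<in> S"
    then obtain a b where ab: "a \<in> {1..n}" "b \<in> {1..n}" "y = c / (g a * g b)"
      by (auto simp: S_def)
    then show "y \<le> c / (g 1 * g 1)"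
      using bounds[OF ab(1)] bounds[OF ab(2)] assms(2)
      by (auto intro!: divide_left_mono mult_mono)
  qed (use mem[of 1 1] assms(1) in auto)
  moreover have "Min S = c / (g n * g n)"
  proof (rule Min_eqI[OF fin])
    fix y assume "y \<in> S"
    then obtain a b where ab: "a \<in> {1..n}" "b \<in> {1..n}" "y = c / (g a * g b)"
      by (auto simp: S_def)
    then show "c / (g n * g n) \<le> y"
      using bounds[OF ab(1)] bounds[OF ab(2)] assms(2)
      by (auto intro!: divide_left_mono mult_mono mult_pos_pos)
  qed (use mem[of n n] assms(1) in auto)
  ultimately show ?thesis
    using bounds[of n] assms(1,2) by (simp add: power2_eq_square)
qed

section \<open>The singular value decomposition\<close>

theorem proposition2p2:
  fixes K N :: nat and \<rho> :: real and \<theta> :: "nat \<Rightarrow> real"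
  assumes "K \<ge> 1" and "N > 2 * K" and "\<rho> > 1"
    and "\<And>s. s \<in> {1..N} \<Longrightarrow> \<theta> s = 2 * pi * real s / real N"
  shows "let V = carrier_mat (2 * K) (2 * K);
             W = carrier_mat N N;
             L = L_op N K \<theta> \<rho>;
             I = {1..2 * K} \<times> {1..2 * K};
             lam = (\<lambda>(a :: nat, b :: nat).
               real N / (8 * pi\<^sup>2 * real_of_int \<lceil>real a / 2\<rceil> * real_of_int \<lceil>real b / 2\<rceil>
                 * \<rho> powi (\<lceil>real a / 2\<rceil> + \<lceil>real b / 2\<rceil>)));
             e = (\<lambda>(a, b). e_mat K a b);
             f = (\<lambda>p. inverse (lam p) \<cdot>\<^sub>m L (e p))
         in singular_value_decomposition V W L I lam e f \<and>
            singular_values V W L = lam ` I \<and>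
            condition_number V W L = (real K)\<^sup>2 * \<rho> ^ (2 * (K - 1))"
proof -
  (* g a is the reciprocal, up to the factor 2 pi, of the a-th diagonal entry of D. *)
  define g :: "nat \<Rightarrow> real" where "g = (\<lambda>a. real ((a + 1) div 2) * \<rho> ^ ((a + 1) div 2))"
  define V where "V = (carrier_mat (2 * K) (2 * K) :: real mat set)"
  define W where "W = (carrier_mat N N :: real mat set)"
  define L where "L = L_op N K \<theta> \<rho>"
  define I where "I = {1..2 * K} \<times> {1..2 * K}"
  define lam where "lam = (\<lambda>(a :: nat, b :: nat). real N / (8 * pi\<^sup>2) / (g a * g b))"
  let ?A = "C_mat N K \<theta> * D_mat K \<rho>"
  have lam_eq: "(\<lambda>(a :: nat, b :: nat).
      real N / (8 * pi\<^sup>2 * real_of_int \<lceil>real a / 2\<rceil> * real_of_int \<lceil>real b / 2\<rceil>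
        * \<rho> powi (\<lceil>real a / 2\<rceil> + \<lceil>real b / 2\<rceil>))) = lam"
  proof -
    have "\<rho> powi (int p + int q) = \<rho> ^ p * \<rho> ^ q" for p q :: nat
      by (simp add: power_add flip: of_nat_add)
    then show ?thesis
      unfolding lam_def ceiling_half g_def by (simp add: mult_ac)
  qed
  have g_pos: "g a > 0" if "1 \<le> a" for a
    using that assms(3) by (auto simp: g_def intro!: mult_pos_pos)
  have g_mono: "g a \<le> g b" if "a \<le> b" for a b
    using that assms(3) unfolding g_def
    by (intro mult_mono power_increasing) (auto simp: div_le_mono)
  have N: "real N > 0"
    using assms(2) by simp
  have index: "(a - 1) div 2 + 1 = (a + 1) div 2" if "a \<in> {1..2 * K}" for a :: nat
    using that by (cases a) simp_all
  have svd: "singular_value_decomposition V W L I lam (\<lambda>(a, b). e_mat K a b)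
      (\<lambda>p. inverse (lam p) \<cdot>\<^sub>m L (case p of (a, b) \<Rightarrow> e_mat K a b))"
    unfolding V_def W_def I_def
  proof (rule congruence_svd[OF _ CD_gram[OF assms(2,4), of \<rho>]])
    show "?A \<in> carrier_mat N (2 * K)"
      by (auto simp: C_mat_def D_mat_diag mat_diag_def)
    show "L M = ?A * M * transpose_mat ?A" if "M \<in> carrier_mat (2 * K) (2 * K)" for M
      unfolding L_def by (rule L_op_congruence[OF that])
    fix a b assume ab: "a \<in> {1..2 * K}" "b \<in> {1..2 * K}"
    show "lam (a, b) > 0"
      using ab g_pos[of a] g_pos[of b] N by (simp add: lam_def)
    show "(lam (a, b))\<^sup>2 =
        real N / (8 * pi\<^sup>2 * (real ((a - 1) div 2 + 1) * \<rho> ^ ((a - 1) div 2 + 1))\<^sup>2) *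
        (real N / (8 * pi\<^sup>2 * (real ((b - 1) div 2 + 1) * \<rho> ^ ((b - 1) div 2 + 1))\<^sup>2))"
      unfolding index[OF ab(1)] index[OF ab(2)] lam_def g_def
      by (simp add: power_divide power_mult_distrib power2_eq_square)
  qed
  then have vals: "singular_values V W L = lam ` I"
    unfolding V_def W_def by (rule singular_values_of_svd[OF refl refl])
  have "condition_number V W L = (g (2 * K) / g 1)\<^sup>2"
    unfolding condition_number_def vals lam_def I_def
    using assms(1) N g_pos g_mono by (intro Max_Min_ratio_product) auto
  also have "\<dots> = (real K * \<rho> ^ (K - 1))\<^sup>2"
    using assms(1,3) by (cases K) (simp_all add: g_def)
  also have "\<dots> = (real K)\<^sup>2 * \<rho> ^ (2 * (K - 1))"
    by (simp add: power_mult_distrib power_mult[symmetric] mult.commute)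
  finally show ?thesis
    using svd vals unfolding Let_def lam_eq
    unfolding V_def[symmetric] W_def[symmetric] L_def[symmetric] I_def[symmetric] by blast
qed

end
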